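(* Let $m\ge 1$, $\rho\in(0,1)$, $\lambda\in(0,1)$ and $x_0\in\mathbb{R}$. Let $X_0,X_1,\ldots,X_m$ be i.i.d. standard normal, let $\mu_1,\ldots,\mu_m\ge 0$, and let $p_i=1-\Phi\left(\mu_i+\sqrt{1-\rho}\,X_i+\sqrt{\rho}\,X_0\right)$ for $1\le i\le m$. Let $G_1,\ldots,G_g$ be a partition of $\{1,\ldots,m\}$ into non-empty sets, $n_j=|G_j|$ and $G_{j0}=\{i\in G_j:\mu_i=0\}$. Let $R_j(\lambda,x_0)$ and $R_j^{(-k)}(\lambda,x_0)$ be the conditional counts defined in the context, and let $P(\lambda,x_0)=\Pr(p_k>\lambda\mid X_0=x_0)$ for $k\in G_{j0}$ (this does not depend on $j$ or on $k\in G_{j0}$). Then for every $j\in\{1,\ldots,g\}$ and every non-negative, real-valued, measurable function $\tilde h$, $$\sum_{k\in G_{j0}}E\left[\frac{\tilde h\left(R_j^{(-k)}(\lambda,x_0)\right)}{n_j-R_j^{(-k)}(\lambda,x_0)}\right]\le\frac{1}{P(\lambda,x_0)}\,E\left[\tilde h\left(R_j(\lambda,x_0)\right)\right].$$ Moreover, with $a=\frac{1}{\sqrt{1-\rho}}$ and $b=-\sqrt{\frac{\rho}{1-\rho}}\,x_0$, if $\lambda\in(0,1/2]$ then $$P(\lambda,x_0)\ge\Phi\left(a\,\Phi^{-1}(1-\lambda)\right)\ \text{ when } b\ge 0,\qquad P(\lambda,x_0)>\frac{\phi(-b)}{1-b}\ \text{ when } b<0.$$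
   Context: $\Phi$ and $\phi$ are the cumulative distribution function and the density of the standard normal distribution. The paper's notation $\mathbf 1\{p_i\le\lambda\mid X_0=x_0\}$ denotes the indicator $\mathbf 1\{p_i\le\lambda\}$ considered under the conditional law given $X_0=x_0$; concretely, with $p_i(x_0)=1-\Phi\left(\mu_i+\sqrt{1-\rho}\,X_i+\sqrt{\rho}\,x_0\right)$, $$R_j(\lambda,x_0)=\sum_{i\in G_j}\mathbf 1\{p_i(x_0)\le\lambda\},\qquad R_j^{(-k)}(\lambda,x_0)=\sum_{i\in G_j\setminus\{k\}}\mathbf 1\{p_i(x_0)\le\lambda\}\quad(k\in G_j),$$ so in particular $\Pr(p_k>\lambda\mid X_0=x_0)=\Pr(p_k(x_0)>\lambda)$. *)

theory Defs
  imports "HOL-Probability.Probability"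
begin

definition Phi :: "real \<Rightarrow> real" where
  "Phi = cdf std_normal_distribution"

text \<open>
  The p-value of hypothesis \<open>i\<close> with the common factor frozen at the value \<open>z\<close>; the unconditional
  p-value is \<open>pval rho mu X i (X 0 \<omega>) \<omega>\<close>.  As the \<open>X i\<close> are independent, conditioning
  on \<open>X 0 = x0\<close> means replacing the common factor by the constant \<open>x0\<close>, so
  \<open>Pr (p k > lam | X 0 = x0)\<close> is read as \<open>\<P>(\<omega> in M. pval rho mu X k x0 \<omega> > lam)\<close>.
\<close>

definition pval :: "real \<Rightarrow> (nat \<Rightarrow> real) \<Rightarrow> (nat \<Rightarrow> 'a \<Rightarrow> real) \<Rightarrow> nat \<Rightarrow> real \<Rightarrow> 'a \<Rightarrow> real" where
  "pval rho mu X i z \<omega> = 1 - Phi (mu i + sqrt (1 - rho) * X i \<omega> + sqrt rho * z)"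

text \<open>
  With \<open>A = G j\<close> this is the conditional count \<open>R_j\<close>, with \<open>A = G j - {k}\<close> the leave-one-out count.
\<close>

definition rej_count ::
  "real \<Rightarrow> (nat \<Rightarrow> real) \<Rightarrow> (nat \<Rightarrow> 'a \<Rightarrow> real) \<Rightarrow> nat set \<Rightarrow> real \<Rightarrow> real \<Rightarrow> 'a \<Rightarrow> nat" where
  "rej_count rho mu X A lam x0 \<omega> = (\<Sum>i\<in>A. of_bool (pval rho mu X i x0 \<omega> \<le> lam))"

definition nulls :: "(nat \<Rightarrow> real) \<Rightarrow> nat set \<Rightarrow> nat set" where
  "nulls mu A = {i \<in> A. mu i = 0}"

end

theory Submission
  imports Defs "HOL-Real_Asymp.Real_Asymp"
begin

text \<open>
  Let \<open>z\<close> be the \<open>1 - lam\<close> quantile and \<open>c = a * z + b\<close>. With the common factor frozen,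
  \<open>p k > lam\<close> iff \<open>X k < c\<close> for a null \<open>k\<close>, so \<open>P = Phi c\<close>. For the inequality, the leave-one-out
  count is independent of the event \<open>p k > lam\<close>, on which it coincides with the full count \<open>R\<close>;
  hence \<open>P\<close> times the left-hand side is the expectation of \<open>h R / (n - R)\<close> times the number of
  unrejected nulls, and that number is at most \<open>n - R\<close>. The lower bounds on \<open>P\<close> follow from
  monotonicity of \<open>Phi\<close> and a Mills-ratio estimate.
\<close>

section \<open>Analytic properties of the standard normal distribution function\<close>

interpretation std_normal: real_distribution std_normal_distribution
  by (rule real_dist_normal_dist)

lemma isCont_std_normal_density: "isCont std_normal_density x"
  unfolding std_normal_density_def by (intro continuous_intros) auto

text \<open>A difference of cdf values is the measure of a half-open interval, while
  \<open>integral\<close> lives on the closed one; the extra endpoint is a null set. This form opens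
  the way to the fundamental theorem of calculus.\<close>

lemma Phi_diff_eq_integral:
  assumes "x < y"
  shows "Phi y - Phi x = integral {x..y} std_normal_density"
proof -
  have ae: "AE t in lborel. indicator {x<..y} t *\<^sub>R std_normal_density t =
      indicator {x..y} t *\<^sub>R std_normal_density t"
    using AE_lborel_singleton[of x] by eventually_elim (auto simp: indicator_def)
  have int: "set_integrable lborel {x..y} std_normal_density"
    unfolding set_integrable_def
    by (intro integrable_mult_indicator integrable_normal_density) auto
  have "emeasure std_normal_distribution {x<..y} =
      (\<integral>\<^sup>+t. ennreal (std_normal_density t) * indicator {x<..y} t \<partial>lborel)"
    by (subst emeasure_density) auto
  also have "\<dots> = (\<integral>\<^sup>+t. ennreal (indicator {x<..y} t *\<^sub>R std_normal_density t) \<partial>lborel)"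
    by (intro nn_integral_cong) (auto simp: indicator_def)
  finally have "measure std_normal_distribution {x<..y} =
      (LINT t:{x<..y}|lborel. std_normal_density t)"
    unfolding set_lebesgue_integral_def measure_def
    by (subst integral_eq_nn_integral) (auto simp: normal_density_nonneg)
  also have "\<dots> = (LINT t:{x..y}|lborel. std_normal_density t)"
    unfolding set_lebesgue_integral_def using ae by (intro integral_cong_AE) auto
  also have "\<dots> = integral {x..y} std_normal_density"
    by (rule set_borel_integral_eq_integral(2)[OF int])
  finally show ?thesis
    using std_normal.cdf_diff_eq[OF assms] by (simp add: Phi_def)
qed

lemma DERIV_Phi: "DERIV Phi x :> std_normal_density x"
proof -
  have "((\<lambda>y. integral {x - 1..y} std_normal_density) has_real_derivative std_normal_density x)
      (at x within {x - 1..x + 1})"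
    by (intro integral_has_real_derivative continuous_at_imp_continuous_on)
       (auto simp: isCont_std_normal_density)
  moreover have "at x within {x - 1..x + 1} = at x"
    by (rule at_within_Icc_at) auto
  ultimately have "DERIV (\<lambda>y. Phi (x - 1) + integral {x - 1..y} std_normal_density) x
      :> std_normal_density x"
    by (auto intro!: derivative_eq_intros)
  then show ?thesis
  proof (rule DERIV_cong_ev[THEN iffD1, rotated -1])
    \<comment> \<open>The integral formula holds only to the right of \<open>x - 1\<close>, hence
      agreement is shown near \<open>x\<close> and not globally.\<close>
    show "\<forall>\<^sub>F y in nhds x. Phi (x - 1) + integral {x - 1..y} std_normal_density = Phi y"
    proof (rule eventually_nhds_in_open[THEN eventually_mono])
      show "open {x - 1<..}" "x \<in> {x - 1<..}" by auto
      show "Phi (x - 1) + integral {x - 1..y} std_normal_density = Phi y"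
        if "y \<in> {x - 1<..}" for y
        using Phi_diff_eq_integral[of "x - 1" y] that by simp
    qed
  qed auto
qed

text \<open>Has the existential shape that the criteria deducing growth from a positive derivative
  expect.\<close>

lemma DERIV_Phi_pos: "\<exists>y. DERIV Phi x :> y \<and> y > 0"
  using DERIV_Phi[of x] normal_density_pos[of 1 0 x] by (intro exI conjI) simp_all

lemma isCont_Phi: "isCont Phi x"
  by (rule DERIV_isCont[OF DERIV_Phi])

lemma strict_mono_Phi: "strict_mono Phi"
  by (rule strict_monoI, erule DERIV_pos_imp_increasing) (rule DERIV_Phi_pos)

lemma Phi_at_bot: "(Phi \<longlongrightarrow> 0) at_bot"
  unfolding Phi_def by (rule std_normal.cdf_lim_at_bot)

lemma Phi_at_top: "(Phi \<longlongrightarrow> 1) at_top"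
  unfolding Phi_def by (rule std_normal.cdf_lim_at_top_prob)

lemma Phi_pos: "0 < Phi x"
  by (rule DERIV_pos_imp_increasing_at_bot[OF DERIV_Phi_pos Phi_at_bot])

text \<open>\<open>inv\<close> picks some preimage, so it suffices that \<open>p\<close> is
  attained: the limits at both infinities provide values on either side of \<open>p\<close>, and the
  intermediate value theorem does the rest.\<close>

lemma Phi_inv:
  assumes "0 < p" "p < 1"
  shows "Phi (inv Phi p) = p"
proof -
  obtain u where u: "Phi u < p"
    using eventually_happens'[OF _ order_tendstoD(2)[OF Phi_at_bot \<open>0 < p\<close>]] by auto
  obtain v where v: "p < Phi v"
    using eventually_happens'[OF _ order_tendstoD(1)[OF Phi_at_top \<open>p < 1\<close>]] by auto
  have "u \<le> v"
    using u v strict_mono_less_eq[OF strict_mono_Phi, of u v] by linarith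
  then obtain z where "Phi z = p"
    using IVT[of Phi u p v] u v by (auto simp: isCont_Phi)
  then show ?thesis
    by (auto intro: f_inv_into_f)
qed

text \<open>The density is even, so \<open>Phi x + Phi (- x)\<close> has derivative 0 and is
  constant; its limit at infinity shows that the constant is 1.\<close>

lemma Phi_0: "Phi 0 = 1 / 2"
proof -
  have D: "DERIV (\<lambda>x. Phi x + Phi (- x)) x :> 0" for x
    using DERIV_add[OF DERIV_Phi DERIV_chain2[OF DERIV_Phi[of "- x"] DERIV_minus[OF DERIV_ident]]]
    by (simp add: std_normal_density_def)
  have "Phi x + Phi (- x) = Phi 0 + Phi 0" for x
    using DERIV_isconst_all[of "\<lambda>x. Phi x + Phi (- x)" x 0] D by simp
  moreover have "((\<lambda>x. Phi x + Phi (- x)) \<longlongrightarrow> 1 + 0) at_top"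
    by (intro tendsto_add Phi_at_top filterlim_compose[OF Phi_at_bot] filterlim_uminus_at_bot_at_top)
  ultimately have "((\<lambda>x::real. Phi 0 + Phi 0) \<longlongrightarrow> 1) at_top"
    by simp
  then show ?thesis
    by (simp add: tendsto_const_iff)
qed

text \<open>
  The difference of the two sides vanishes at \<open>-\<infinity>\<close> and has derivative
  \<open>- x * std_normal_density x / (1 - x)\<^sup>2\<close>, which is positive for \<open>x < 0\<close>.
\<close>
lemma std_normal_density_div_less_Phi:
  assumes "b < 0"
  shows "std_normal_density b / (1 - b) < Phi b"
proof -
  define F where "F = (\<lambda>x. Phi x - std_normal_density x / (1 - x))"
  have "0 < F b"
  proof (rule DERIV_pos_imp_increasing_at_bot[of b F])
    fix x assume "x \<le> b"
    with assms have x: "x < 0" by simp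
    \<comment> \<open>Here \<open>r\<close> stands for the normalising constant of the density,
      which the calculation need not know.\<close>
    have "DERIV (\<lambda>x. r * exp (- x\<^sup>2 / 2)) x :> - x * (r * exp (- x\<^sup>2 / 2))" for r :: real
      by (auto intro!: derivative_eq_intros)
    then have dd: "DERIV std_normal_density x :> - x * std_normal_density x"
      unfolding std_normal_density_def .
    have "DERIV F x :> std_normal_density x -
        ((- x * std_normal_density x) * (1 - x) - std_normal_density x * (0 - 1)) / ((1 - x) * (1 - x))"
      unfolding F_def using x
      by (intro DERIV_diff DERIV_divide DERIV_Phi dd DERIV_const DERIV_ident) auto
    moreover have "std_normal_density x -
        ((- x * std_normal_density x) * (1 - x) - std_normal_density x * (0 - 1)) / ((1 - x) * (1 - x))
        = - x * std_normal_density x / (1 - x)\<^sup>2"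
    proof -
      \<comment> \<open>With \<open>d\<close> for \<open>1 - x\<close> and \<open>p\<close> for the
        density value, the identity is purely rational.\<close>
      have "p - ((- (1 - d) * p) * d - p * (0 - 1)) / (d * d) = - (1 - d) * p / d\<^sup>2"
        if "d \<noteq> 0" for p d :: real
        using that by (simp add: field_simps power2_eq_square)
      from this[of "1 - x"] show ?thesis using x by simp
    qed
    moreover have "0 < - x * std_normal_density x / (1 - x)\<^sup>2"
      using x by (intro divide_pos_pos mult_pos_pos normal_density_pos) auto
    ultimately show "\<exists>y. DERIV F x :> y \<and> y > 0" by auto
  next
    have "((\<lambda>x. std_normal_density x / (1 - x)) \<longlongrightarrow> 0) at_bot"
      unfolding std_normal_density_def by real_asymp
    then show "(F \<longlongrightarrow> 0) at_bot"
      unfolding F_def using tendsto_diff[OF Phi_at_bot] by fastforce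
  qed
  then show ?thesis by (simp add: F_def)
qed

section \<open>Normal probabilities of half-lines and the leave-one-out inequality\<close>

text \<open>The open half-line has as measure the left limit of the cdf, which equals
  \<open>Phi c\<close> because \<open>Phi\<close> is continuous.\<close>

lemma (in prob_space) prob_std_normal_less:
  assumes "distributed M lborel Y std_normal_density"
  shows "\<P>(\<omega> in M. Y \<omega> < c) = Phi c"
proof -
  have Y: "Y \<in> borel_measurable M"
    using distributed_measurable[OF assms] by simp
  have eq: "distr M borel Y = std_normal_distribution"
    using distributed_distr_eq_density[OF assms] by (simp cong: distr_cong)
  have "measure std_normal_distribution {..<c} = Phi c"
  proof (rule tendsto_unique[OF _ std_normal.cdf_at_left])
    show "(cdf std_normal_distribution \<longlongrightarrow> Phi c) (at_left c)"
      using isCont_Phi[of c] unfolding Phi_def isCont_def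
      by (rule filterlim_mono) (auto intro: at_le)
  qed simp
  then show ?thesis
    unfolding eq[symmetric] using Y
    by (subst (asm) measure_distr) (auto simp: vimage_def Int_def conj_commute)
qed

text \<open>The probabilistic core, freed from the normal model: \<open>B i\<close> plays the event
  that hypothesis \<open>i\<close> is rejected, \<open>A\<close> a group and \<open>N\<close> its
  nulls. Only independence and the common probability of non-rejection on \<open>N\<close>
  enter.\<close>

lemma (in prob_space) leave_one_out_sum_le:
  fixes B :: "'i \<Rightarrow> 'a \<Rightarrow> bool" and h :: "real \<Rightarrow> real"
    and R :: "'i set \<Rightarrow> 'a \<Rightarrow> real"
  defines "R \<equiv> \<lambda>S \<omega>. \<Sum>i\<in>S. of_bool (B i \<omega>)"
  assumes indep: "indep_vars (\<lambda>_. count_space UNIV) B A"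
    and "finite A" "N \<subseteq> A"
    and P: "\<And>k. k \<in> N \<Longrightarrow> \<P>(\<omega> in M. \<not> B k \<omega>) = P"
    and h[measurable]: "h \<in> borel_measurable borel" and h_nonneg: "\<And>x. 0 \<le> h x"
  shows "P * (\<Sum>k\<in>N. expectation (\<lambda>\<omega>. h (R (A - {k}) \<omega>) / (card A - R (A - {k}) \<omega>)))
    \<le> expectation (\<lambda>\<omega>. h (R A \<omega>))"
proof -
  have B: "Measurable.pred M (B i)" if "i \<in> A" for i
    using indep that unfolding indep_vars_def by auto
  have R: "R S \<in> borel_measurable M" if "S \<subseteq> A" for S
  proof -
    have "(\<lambda>\<omega>. of_bool (B i \<omega>) :: real) \<in> borel_measurable M" if "i \<in> S" for i
    proof -
      have [measurable]: "Measurable.pred M (B i)" using B that \<open>S \<subseteq> A\<close> by auto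
      show ?thesis by measurable
    qed
    then show ?thesis unfolding R_def by (rule borel_measurable_sum)
  qed
  have R_values: "R S \<omega> \<in> real ` {..card A}" if "S \<subseteq> A" for S \<omega>
  proof -
    have "R S \<omega> = real (card {i \<in> S. B i \<omega>})"
      unfolding R_def using finite_subset[OF that \<open>finite A\<close>]
      by (simp add: of_bool_def sum.If_cases Int_def)
    moreover have "card {i \<in> S. B i \<omega>} \<le> card A"
      using that by (intro card_mono \<open>finite A\<close>) auto
    ultimately show ?thesis by auto
  qed
  \<comment> \<open>A count takes finitely many values, so every function of it is bounded; no
    growth condition on \<open>h\<close> is required.\<close>
  have int: "integrable M (\<lambda>\<omega>. f (R S \<omega>))"
    if "S \<subseteq> A" "f \<in> borel_measurable borel" for S and f :: "real \<Rightarrow> real"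
  proof (rule integrable_const_bound[where B = "Max (abs ` f ` real ` {..card A})"])
    show "AE \<omega> in M. norm (f (R S \<omega>)) \<le> Max (abs ` f ` real ` {..card A})"
      using R_values[OF that(1)] by (intro AE_I2 Max_ge) auto
    show "(\<lambda>\<omega>. f (R S \<omega>)) \<in> borel_measurable M"
      using measurable_compose[OF R[OF that(1)] that(2)] by simp
  qed
  define f where "f = (\<lambda>x::real. h x / (card A - x))"
  have f[measurable]: "f \<in> borel_measurable borel"
    unfolding f_def by measurable
  have B_int: "integrable M (\<lambda>\<omega>. of_bool (\<not> B k \<omega>) :: real)" if "k \<in> A" for k
  proof (rule integrable_const_bound[where B = 1])
    have [measurable]: "Measurable.pred M (B k)" by (rule B[OF that])
    show "(\<lambda>\<omega>. of_bool (\<not> B k \<omega>) :: real) \<in> borel_measurable M" by measurable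
  qed auto
  have product: "integrable M (\<lambda>\<omega>. of_bool (\<not> B k \<omega>) * f (R A \<omega>)) \<and>
      expectation (\<lambda>\<omega>. of_bool (\<not> B k \<omega>) * f (R A \<omega>)) = P * expectation (\<lambda>\<omega>. f (R (A - {k}) \<omega>))"
    if "k \<in> N" for k
  proof -
    have k: "k \<in> A" using that \<open>N \<subseteq> A\<close> by auto
    let ?D = "\<lambda>_. count_space (UNIV :: bool set)"
    \<comment> \<open>The coordinate \<open>k\<close> and the remaining ones form disjoint blocks of
      an independent family.\<close>
    have "indep_var
        (PiM {k} ?D) (\<lambda>\<omega>. restrict (\<lambda>i. B i \<omega>) {k})
        (PiM (A - {k}) ?D) (\<lambda>\<omega>. restrict (\<lambda>i. B i \<omega>) (A - {k}))"
      using k by (intro indep_var_restrict[OF indep]) auto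
    then have "indep_var
        borel ((\<lambda>v. of_bool (\<not> v k) :: real) \<circ> (\<lambda>\<omega>. restrict (\<lambda>i. B i \<omega>) {k}))
        borel ((\<lambda>v. f (\<Sum>i\<in>A - {k}. of_bool (v i))) \<circ> (\<lambda>\<omega>. restrict (\<lambda>i. B i \<omega>) (A - {k})))"
      by (rule indep_var_compose) measurable
    then have ind: "indep_var borel (\<lambda>\<omega>. of_bool (\<not> B k \<omega>) :: real)
        borel (\<lambda>\<omega>. f (R (A - {k}) \<omega>))"
      by (simp add: comp_def R_def)
    \<comment> \<open>Both sides vanish if \<open>B k\<close> holds; otherwise \<open>k\<close> adds
      nothing to the full count.\<close>
    have eq: "of_bool (\<not> B k \<omega>) * f (R A \<omega>) = of_bool (\<not> B k \<omega>) * f (R (A - {k}) \<omega>)" for \<omega>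
      using sum.remove[OF \<open>finite A\<close> k, of "\<lambda>i. of_bool (B i \<omega>) :: real"] by (simp add: R_def)
    have "expectation (\<lambda>\<omega>. of_bool (\<not> B k \<omega>)) = P"
    proof -
      have "(\<lambda>\<omega>. of_bool (\<not> B k \<omega>) :: real) = indicator {\<omega>. \<not> B k \<omega>}"
        by (auto simp: indicator_def)
      then show ?thesis
        using P[OF that] by (simp add: Int_def conj_commute)
    qed
    then show ?thesis
      using indep_var_integrable[OF ind B_int[OF k] int[OF _ f]]
        indep_var_lebesgue_integral[OF ind B_int[OF k] int[OF _ f]]
      unfolding eq by auto
  qed
  have "P * (\<Sum>k\<in>N. expectation (\<lambda>\<omega>. f (R (A - {k}) \<omega>))) =
      (\<Sum>k\<in>N. expectation (\<lambda>\<omega>. of_bool (\<not> B k \<omega>) * f (R A \<omega>)))"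
    using product by (simp add: sum_distrib_left)
  also have "\<dots> = expectation (\<lambda>\<omega>. \<Sum>k\<in>N. of_bool (\<not> B k \<omega>) * f (R A \<omega>))"
    using product by (intro Bochner_Integration.integral_sum[symmetric]) auto
  also have "\<dots> \<le> expectation (\<lambda>\<omega>. h (R A \<omega>))"
  proof (rule integral_mono)
    fix \<omega>
    have "(\<Sum>k\<in>N. of_bool (\<not> B k \<omega>) :: real) \<le> (\<Sum>k\<in>A. of_bool (\<not> B k \<omega>))"
      by (intro sum_mono2 \<open>finite A\<close> \<open>N \<subseteq> A\<close>) auto
    also have "\<dots> = card A - R A \<omega>"
      unfolding R_def by (simp add: of_bool_not_iff sum_subtractf)
    finally have le: "(\<Sum>k\<in>N. of_bool (\<not> B k \<omega>)) \<le> card A - R A \<omega>" .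
    have f_nonneg: "0 \<le> f (R A \<omega>)"
      unfolding f_def using R_values[of A \<omega>] by (auto intro!: divide_nonneg_nonneg h_nonneg)
    have "(\<Sum>k\<in>N. of_bool (\<not> B k \<omega>) * f (R A \<omega>)) \<le> (card A - R A \<omega>) * f (R A \<omega>)"
      unfolding sum_distrib_right[symmetric] by (rule mult_right_mono[OF le f_nonneg])
    \<comment> \<open>Equality unless the full count reaches \<open>card A\<close>; then the left
      side is 0 and \<open>h_nonneg\<close> applies.\<close>
    also have "\<dots> \<le> h (R A \<omega>)"
      by (simp add: f_def h_nonneg)
    finally show "(\<Sum>k\<in>N. of_bool (\<not> B k \<omega>) * f (R A \<omega>)) \<le> h (R A \<omega>)" .
  qed (use product in \<open>auto intro!: int\<close>)
  finally show ?thesis by (simp add: f_def)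
qed

section \<open>Grouped p-values with the common factor frozen\<close>

theorem lemma4:
  fixes M :: "'a measure" and X :: "nat \<Rightarrow> 'a \<Rightarrow> real" and mu :: "nat \<Rightarrow> real"
    and G :: "nat \<Rightarrow> nat set" and m g :: nat and rho lam x0 :: real
  assumes "prob_space M"
    and "m \<ge> 1" and "0 < rho" "rho < 1" and "0 < lam" "lam < 1"
    and "prob_space.indep_vars M (\<lambda>_. borel) X {0..m}"
    and "\<And>i. i \<in> {0..m} \<Longrightarrow> distributed M lborel (X i) std_normal_density"
    and "\<And>i. i \<in> {1..m} \<Longrightarrow> mu i \<ge> 0"
    and "(\<Union>j\<in>{1..g}. G j) = {1..m}" and "disjoint_family_on G {1..g}"
    and "\<And>j. j \<in> {1..g} \<Longrightarrow> G j \<noteq> {}"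
  shows "\<exists>P :: real.
    (\<forall>j\<in>{1..g}. \<forall>k\<in>nulls mu (G j). \<P>(\<omega> in M. pval rho mu X k x0 \<omega> > lam) = P) \<and>
    (\<forall>j\<in>{1..g}. \<forall>h :: real \<Rightarrow> real. h \<in> borel_measurable borel \<longrightarrow> (\<forall>x. 0 \<le> h x) \<longrightarrow>
      (\<Sum>k\<in>nulls mu (G j).
        (\<integral>\<omega>. h (real (rej_count rho mu X (G j - {k}) lam x0 \<omega>)) /
              (real (card (G j)) - real (rej_count rho mu X (G j - {k}) lam x0 \<omega>)) \<partial>M))
      \<le> 1 / P * (\<integral>\<omega>. h (real (rej_count rho mu X (G j) lam x0 \<omega>)) \<partial>M)) \<and>
    (let a = 1 / sqrt (1 - rho); b = - (sqrt (rho / (1 - rho)) * x0) in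
      lam \<le> 1 / 2 \<longrightarrow>
        (b \<ge> 0 \<longrightarrow> P \<ge> Phi (a * inv Phi (1 - lam))) \<and>
        (b < 0 \<longrightarrow> P > std_normal_density (- b) / (1 - b)))"
proof -
  interpret prob_space M by fact
  note indep = assms(7) and normal = assms(8)
  define s where "s = sqrt (1 - rho)"
  have s: "s > 0" using \<open>rho < 1\<close> by (simp add: s_def)
  define z where "z = inv Phi (1 - lam)"
  have Phi_z: "Phi z = 1 - lam"
    unfolding z_def using \<open>0 < lam\<close> \<open>lam < 1\<close> by (intro Phi_inv) auto
  have pval_iff: "pval rho mu X i x0 \<omega> > lam \<longleftrightarrow> X i \<omega> < (z - mu i - sqrt rho * x0) / s" for i \<omega>
  proof -
    have "pval rho mu X i x0 \<omega> > lam \<longleftrightarrow> Phi (mu i + s * X i \<omega> + sqrt rho * x0) < Phi z"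
      by (auto simp: pval_def s_def Phi_z)
    also have "\<dots> \<longleftrightarrow> mu i + s * X i \<omega> + sqrt rho * x0 < z"
      by (rule strict_mono_less[OF strict_mono_Phi])
    also have "\<dots> \<longleftrightarrow> X i \<omega> < (z - mu i - sqrt rho * x0) / s"
      using s by (auto simp: pos_less_divide_eq mult.commute)
    finally show ?thesis .
  qed
  \<comment> \<open>The threshold of \<open>pval_iff\<close> at \<open>mu i = 0\<close>. Being an
    explicit value, it serves as witness even if no group contains a null.\<close>
  define P where "P = Phi ((z - sqrt rho * x0) / s)"
  have G_sub: "G j \<subseteq> {0..m}" "finite (G j)" if "j \<in> {1..g}" for j
  proof -
    have "G j \<subseteq> {1..m}" using assms(10) that by blast
    then show "G j \<subseteq> {0..m}" "finite (G j)"
      by (auto intro: finite_subset)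
  qed
  have P: "\<P>(\<omega> in M. pval rho mu X k x0 \<omega> > lam) = P" if "j \<in> {1..g}" "k \<in> nulls mu (G j)" for j k
  proof -
    have "k \<in> {0..m}" "mu k = 0" using that G_sub(1)[OF that(1)] by (auto simp: nulls_def)
    then show ?thesis
      unfolding pval_iff P_def using prob_std_normal_less[OF normal] by simp
  qed
  have main: "(\<Sum>k\<in>nulls mu (G j).
        (\<integral>\<omega>. h (real (rej_count rho mu X (G j - {k}) lam x0 \<omega>)) /
              (real (card (G j)) - real (rej_count rho mu X (G j - {k}) lam x0 \<omega>)) \<partial>M))
      \<le> 1 / P * (\<integral>\<omega>. h (real (rej_count rho mu X (G j) lam x0 \<omega>)) \<partial>M)"
    if j: "j \<in> {1..g}" and h: "h \<in> borel_measurable borel" "\<forall>x. 0 \<le> h x"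
    for j and h :: "real \<Rightarrow> real"
  proof -
    define B where "B = (\<lambda>i \<omega>. pval rho mu X i x0 \<omega> \<le> lam)"
    \<comment> \<open>Writing each event as a function of \<open>X i\<close> alone lets independence
      pass from \<open>X\<close> to \<open>B\<close>.\<close>
    have "B = (\<lambda>i \<omega>. \<not> X i \<omega> < (z - mu i - sqrt rho * x0) / s)"
      unfolding B_def pval_iff[symmetric] by (simp add: not_less)
    then have "indep_vars (\<lambda>_. count_space UNIV) B (G j)"
      using indep_vars_compose2[OF indep_vars_subset[OF indep G_sub(1)[OF j]],
        of "\<lambda>i x. \<not> x < (z - mu i - sqrt rho * x0) / s" "\<lambda>_. count_space UNIV"] by simp
    moreover have "\<P>(\<omega> in M. \<not> B k \<omega>) = P" if "k \<in> nulls mu (G j)" for k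
      using P[OF j that] by (simp add: B_def not_le)
    moreover have "nulls mu (G j) \<subseteq> G j" by (auto simp: nulls_def)
    ultimately have "P * (\<Sum>k\<in>nulls mu (G j).
        (\<integral>\<omega>. h (real (rej_count rho mu X (G j - {k}) lam x0 \<omega>)) /
              (real (card (G j)) - real (rej_count rho mu X (G j - {k}) lam x0 \<omega>)) \<partial>M))
      \<le> (\<integral>\<omega>. h (real (rej_count rho mu X (G j) lam x0 \<omega>)) \<partial>M)"
      using leave_one_out_sum_le[of B "G j" "nulls mu (G j)" P h] G_sub(2)[OF j] h
      by (simp add: rej_count_def B_def)
    then show ?thesis
      using Phi_pos by (simp add: P_def pos_le_divide_eq mult.commute)
  qed
  define a where "a = 1 / sqrt (1 - rho)"
  define b where "b = - (sqrt (rho / (1 - rho)) * x0)"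
  have P_eq: "P = Phi (a * z + b)"
    by (simp add: P_def a_def b_def real_sqrt_divide s_def[symmetric] diff_divide_distrib)
  have bound1: "P \<ge> Phi (a * z)" if "b \<ge> 0"
    unfolding P_eq using that by (simp add: strict_mono_less_eq[OF strict_mono_Phi])
  have bound2: "P > std_normal_density (- b) / (1 - b)" if "b < 0" "lam \<le> 1 / 2"
  proof -
    \<comment> \<open>From \<open>lam\<close> at most 1/2 the quantile \<open>z\<close> is
      nonnegative, so \<open>a * z + b\<close> is at least \<open>b\<close> and the bound for
      \<open>Phi b\<close> carries over to \<open>P\<close>.\<close>
    have "Phi 0 \<le> Phi z" using that by (simp add: Phi_0 Phi_z)
    then have "0 \<le> z" by (simp add: strict_mono_less_eq[OF strict_mono_Phi])
    then have "Phi b \<le> P"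
      unfolding P_eq using s
      by (simp add: strict_mono_less_eq[OF strict_mono_Phi] a_def s_def[symmetric])
    moreover have "std_normal_density (- b) = std_normal_density b"
      by (simp add: std_normal_density_def)
    ultimately show ?thesis
      using std_normal_density_div_less_Phi[OF \<open>b < 0\<close>] by simp
  qed
  show ?thesis
    unfolding Let_def a_def[symmetric] b_def[symmetric] z_def[symmetric]
    using P main bound1 bound2 by (intro exI[of _ P] conjI ballI allI impI) auto
qed

end
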